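(* Let $(A,1_l)$ be a left-unital algebra. Then $AC_l(A)\cdot 1_l$ is a commutative associative subalgebra of $(A,1_l)$. Moreover, $\left(AC_l(A)\cdot 1_l\right)^2\subseteq Ann_A^l([A,A,A]_{\mathrm{as}})$.
   Context: An algebra $A$ over a field $\mathbb{F}$ is a linear space with a bilinear product $(x,y)\mapsto x\cdot y$ (not assumed associative or commutative). It is left-unital if equipped with $1_l\in A$ such that $1_l\cdot x=x$ for all $x\in A$. Define $$AC_l(A)=\{a\in A\mid a\cdot(x\cdot z)=x\cdot(a\cdot z),\ (a\cdot x)\cdot(y\cdot z)=a\cdot((x\cdot y)\cdot z)\ \forall x,y,z\in A\},$$ $$AC_l(A)\cdot 1_l=\{a\cdot 1_l\mid a\in AC_l(A)\}.$$ $(AC_l(A)\cdot 1_l)^2$ consists of the products $b\cdot b'$ with $b,b'\in AC_l(A)\cdot 1_l$ (equivalently for this inclusion, their span). $[x,y,z]_{\mathrm{as}}=(x\cdot y)\cdot z-x\cdot(y\cdot z)$, $[A,A,A]_{\mathrm{as}}$ is the set of all associators, and $Ann_A^l(S)=\{a\in A\mid a\cdot s=0\ \forall s\in S\}$. *)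

theory Defs imports Complex_Main begin

text \<open>
  The product is bilinear but neither associative nor commutative in general, so it is kept as a
  locale parameter rather than taken from the multiplicative type classes. The underlying linear
  space is the whole type, with scalars from an arbitrary field.
\<close>

locale nonassoc_algebra = vector_space scale
  for scale :: "'f::field \<Rightarrow> 'a::ab_group_add \<Rightarrow> 'a" (infixr \<open>*s\<close> 75) +
  fixes mul :: "'a \<Rightarrow> 'a \<Rightarrow> 'a" (infixl \<open>\<cdot>\<close> 70)
  assumes linear_mul_left: "Vector_Spaces.linear scale scale (\<lambda>x. x \<cdot> y)"
    and linear_mul_right: "Vector_Spaces.linear scale scale (\<lambda>y. x \<cdot> y)"

locale left_unital_algebra = nonassoc_algebra scale mul
  for scale :: "'f::field \<Rightarrow> 'a::ab_group_add \<Rightarrow> 'a" (infixr \<open>*s\<close> 75)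
    and mul :: "'a \<Rightarrow> 'a \<Rightarrow> 'a" (infixl \<open>\<cdot>\<close> 70) +
  fixes one_l :: 'a
  assumes left_unit: "one_l \<cdot> x = x"

text \<open>
  A subalgebra is a linear subspace closed under the product; it need not contain the left unit.
\<close>

definition subalgebra ::
  "('f::field \<Rightarrow> 'a::ab_group_add \<Rightarrow> 'a) \<Rightarrow> ('a \<Rightarrow> 'a \<Rightarrow> 'a) \<Rightarrow> 'a set \<Rightarrow> bool" where
  "subalgebra scale mul S \<longleftrightarrow>
     module.subspace scale S \<and> (\<forall>x\<in>S. \<forall>y\<in>S. mul x y \<in> S)"

definition commutative_on :: "('a \<Rightarrow> 'a \<Rightarrow> 'a) \<Rightarrow> 'a set \<Rightarrow> bool" where
  "commutative_on mul S \<longleftrightarrow> (\<forall>x\<in>S. \<forall>y\<in>S. mul x y = mul y x)"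

definition associative_on :: "('a \<Rightarrow> 'a \<Rightarrow> 'a) \<Rightarrow> 'a set \<Rightarrow> bool" where
  "associative_on mul S \<longleftrightarrow>
     (\<forall>x\<in>S. \<forall>y\<in>S. \<forall>z\<in>S. mul (mul x y) z = mul x (mul y z))"

definition AC_l :: "('a \<Rightarrow> 'a \<Rightarrow> 'a) \<Rightarrow> 'a set" where
  "AC_l mul = {a. \<forall>x y z. mul a (mul x z) = mul x (mul a z) \<and>
                          mul (mul a x) (mul y z) = mul a (mul (mul x y) z)}"

definition AC_l_one :: "('a \<Rightarrow> 'a \<Rightarrow> 'a) \<Rightarrow> 'a \<Rightarrow> 'a set" where
  "AC_l_one mul e = {mul a e | a. a \<in> AC_l mul}"

definition set_square :: "('a \<Rightarrow> 'a \<Rightarrow> 'a) \<Rightarrow> 'a set \<Rightarrow> 'a set" where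
  "set_square mul S = {mul b b' | b b'. b \<in> S \<and> b' \<in> S}"

definition associator :: "('a::ab_group_add \<Rightarrow> 'a \<Rightarrow> 'a) \<Rightarrow> 'a \<Rightarrow> 'a \<Rightarrow> 'a \<Rightarrow> 'a" where
  "associator mul x y z = mul (mul x y) z - mul x (mul y z)"

definition associators :: "('a::ab_group_add \<Rightarrow> 'a \<Rightarrow> 'a) \<Rightarrow> 'a set" where
  "associators mul = {associator mul x y z | x y z. True}"

definition left_annihilator :: "('a::ab_group_add \<Rightarrow> 'a \<Rightarrow> 'a) \<Rightarrow> 'a set \<Rightarrow> 'a set" where
  "left_annihilator mul S = {a. \<forall>s\<in>S. mul a s = 0}"

end

theory Submission imports Defs begin

text \<open>
  Write \<open>e\<close> for the left unit. Whether \<open>a\<close> belongs to \<open>AC\<^sub>l(A)\<close> depends only on the operator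
  \<open>L\<^sub>a : x \<mapsto> a \<cdot> x\<close>, and the second defining identity with \<open>x = y = e\<close> says that \<open>a \<cdot> e\<close> and \<open>a\<close> have
  the same operator. Hence \<open>AC\<^sub>l(A) \<cdot> e\<close> is precisely the set of those \<open>b \<in> AC\<^sub>l(A)\<close> with
  \<open>b \<cdot> e = b\<close> (\<open>AC_l_one_iff\<close>), so its elements may be treated as honest members of \<open>AC\<^sub>l(A)\<close> on which
  \<open>e\<close> also acts as a right unit.

  For two such elements \<open>b, b'\<close>, commutativity is the first defining identity applied to
  \<open>b \<cdot> (b' \<cdot> e)\<close>, and \<open>L\<^bsub>b \<cdot> b'\<^esub> = L\<^sub>b L\<^bsub>b'\<^esub>\<close> (\<open>mul_AC_l_one_left\<close>), which contains associativity.

  The crux is that \<open>c = b \<cdot> b'\<close> does not distinguish \<open>y \<cdot> z\<close> from \<open>(y \<cdot> e) \<cdot> z\<close>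
  (\<open>product_absorbs_one_l\<close>): by the second identity both \<open>c \<cdot> (y \<cdot> z)\<close> and \<open>c \<cdot> ((y \<cdot> e) \<cdot> z)\<close> equal
  \<open>b \<cdot> ((b' \<cdot> y) \<cdot> z)\<close>. A single element \<open>b\<close> only moves brackets at the cost of inserting \<open>\<cdot> e\<close>;
  a product \<open>c\<close> makes these insertions harmless, and therefore kills all associators
  (\<open>product_rebracket\<close>). The same rebracketing gives \<open>c \<in> AC\<^sub>l(A)\<close>, that is, closure under products;
  so the annihilation statement comes before closure, not after it.
\<close>

context left_unital_algebra
begin

lemma AC_l_exchange: "a \<in> AC_l mul \<Longrightarrow> a \<cdot> (x \<cdot> z) = x \<cdot> (a \<cdot> z)"
  by (simp add: AC_l_def)

lemma AC_l_shift: "a \<in> AC_l mul \<Longrightarrow> (a \<cdot> x) \<cdot> (y \<cdot> z) = a \<cdot> ((x \<cdot> y) \<cdot> z)"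
  by (simp add: AC_l_def)

lemma AC_l_mul_left:
  assumes "a \<in> AC_l mul"
  shows "(a \<cdot> x) \<cdot> z = a \<cdot> ((x \<cdot> one_l) \<cdot> z)"
  using AC_l_shift[OF assms, of x one_l z] by (simp add: left_unit)

lemma mul_one_l_left_action:
  assumes "a \<in> AC_l mul"
  shows "(a \<cdot> one_l) \<cdot> z = a \<cdot> z"
  using AC_l_mul_left[OF assms, of one_l z] by (simp add: left_unit)

text \<open>
  Right multiplication by the left unit is an idempotent map of \<open>AC\<^sub>l(A)\<close> into itself, because it
  preserves the operator of left multiplication; its image is its set of fixed points.
\<close>

lemma AC_l_one_iff: "b \<in> AC_l_one mul one_l \<longleftrightarrow> b \<in> AC_l mul \<and> b \<cdot> one_l = b"
proof
  assume "b \<in> AC_l_one mul one_l"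
  then obtain a where a: "a \<in> AC_l mul" and b: "b = a \<cdot> one_l"
    by (auto simp: AC_l_one_def)
  have act: "b \<cdot> z = a \<cdot> z" for z
    by (simp add: b mul_one_l_left_action[OF a])
  have "b \<in> AC_l mul"
    using a by (simp add: AC_l_def act)
  then show "b \<in> AC_l mul \<and> b \<cdot> one_l = b"
    using act b by simp
next
  assume "b \<in> AC_l mul \<and> b \<cdot> one_l = b"
  then show "b \<in> AC_l_one mul one_l"
    by (force simp: AC_l_one_def)
qed

lemma AC_l_one_commute:
  assumes "b \<in> AC_l_one mul one_l" and "b' \<in> AC_l_one mul one_l"
  shows "b \<cdot> b' = b' \<cdot> b"
  using assms AC_l_exchange[of b b' one_l] by (simp add: AC_l_one_iff)

lemma mul_AC_l_one_left:
  assumes "a \<in> AC_l mul" and "b \<in> AC_l_one mul one_l"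
  shows "(a \<cdot> b) \<cdot> z = a \<cdot> (b \<cdot> z)"
  using assms by (simp add: AC_l_one_iff AC_l_mul_left)

lemma product_absorbs_one_l:
  assumes "a \<in> AC_l mul" and "b \<in> AC_l_one mul one_l"
  shows "(a \<cdot> b) \<cdot> ((y \<cdot> one_l) \<cdot> z) = (a \<cdot> b) \<cdot> (y \<cdot> z)"
proof -
  have b: "b \<in> AC_l mul"
    using assms by (simp add: AC_l_one_iff)
  have "(a \<cdot> b) \<cdot> (y \<cdot> z) = a \<cdot> ((b \<cdot> y) \<cdot> z)"
    by (rule AC_l_shift[OF assms(1)])
  also have "\<dots> = a \<cdot> (b \<cdot> ((y \<cdot> one_l) \<cdot> z))"
    by (simp only: AC_l_mul_left[OF b])
  also have "\<dots> = (a \<cdot> b) \<cdot> ((y \<cdot> one_l) \<cdot> z)"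
    by (simp only: mul_AC_l_one_left[OF assms])
  finally show ?thesis ..
qed

text \<open>
  The factor \<open>b\<close> turns \<open>(x \<cdot> y) \<cdot> z\<close> into \<open>(b \<cdot> x) \<cdot> (y \<cdot> z)\<close>, where \<open>b\<close> can be pulled out again to leave
  \<open>(x \<cdot> e) \<cdot> (y \<cdot> z)\<close>; the surplus \<open>e\<close> is then absorbed by the product.
\<close>

lemma product_rebracket:
  assumes "a \<in> AC_l mul" and "b \<in> AC_l_one mul one_l"
  shows "(a \<cdot> b) \<cdot> ((x \<cdot> y) \<cdot> z) = (a \<cdot> b) \<cdot> (x \<cdot> (y \<cdot> z))"
proof -
  have b: "b \<in> AC_l mul"
    using assms by (simp add: AC_l_one_iff)
  have "(a \<cdot> b) \<cdot> ((x \<cdot> y) \<cdot> z) = a \<cdot> ((b \<cdot> x) \<cdot> (y \<cdot> z))"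
    by (simp only: mul_AC_l_one_left[OF assms] AC_l_shift[OF b])
  also have "\<dots> = (a \<cdot> b) \<cdot> ((x \<cdot> one_l) \<cdot> (y \<cdot> z))"
    by (simp only: mul_AC_l_one_left[OF assms] AC_l_mul_left[OF b])
  also have "\<dots> = (a \<cdot> b) \<cdot> (x \<cdot> (y \<cdot> z))"
    by (rule product_absorbs_one_l[OF assms])
  finally show ?thesis .
qed

lemma AC_l_one_mul_closed:
  assumes "b \<in> AC_l_one mul one_l" and "b' \<in> AC_l_one mul one_l"
  shows "b \<cdot> b' \<in> AC_l_one mul one_l"
proof -
  have b: "b \<in> AC_l mul" and b': "b' \<in> AC_l mul" and "b' \<cdot> one_l = b'"
    using assms by (simp_all add: AC_l_one_iff)
  note act = mul_AC_l_one_left[OF b assms(2)]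
  have exchange: "(b \<cdot> b') \<cdot> (x \<cdot> z) = x \<cdot> ((b \<cdot> b') \<cdot> z)" for x z
    by (simp only: act AC_l_exchange[OF b'] AC_l_exchange[OF b, of x])
  have shift: "((b \<cdot> b') \<cdot> x) \<cdot> (y \<cdot> z) = (b \<cdot> b') \<cdot> ((x \<cdot> y) \<cdot> z)" for x y z
  proof -
    have "((b \<cdot> b') \<cdot> x) \<cdot> (y \<cdot> z) = b \<cdot> (((b' \<cdot> x) \<cdot> y) \<cdot> z)"
      by (simp only: act AC_l_shift[OF b])
    also have "\<dots> = (b \<cdot> b') \<cdot> ((((x \<cdot> one_l) \<cdot> y) \<cdot> one_l) \<cdot> z)"
      by (simp only: act AC_l_mul_left[OF b'])
    \<comment> \<open>Rebracketing to the right makes both inserted units act from the left, where they vanish.\<close>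
    also have "\<dots> = (b \<cdot> b') \<cdot> (x \<cdot> (y \<cdot> z))"
      by (simp only: product_rebracket[OF b assms(2)] left_unit)
    also have "\<dots> = (b \<cdot> b') \<cdot> ((x \<cdot> y) \<cdot> z)"
      by (rule product_rebracket[OF b assms(2), symmetric])
    finally show ?thesis .
  qed
  have "b \<cdot> b' \<in> AC_l mul"
    using exchange shift by (simp add: AC_l_def)
  moreover have "(b \<cdot> b') \<cdot> one_l = b \<cdot> b'"
    by (simp add: act \<open>b' \<cdot> one_l = b'\<close>)
  ultimately show ?thesis
    by (simp add: AC_l_one_iff)
qed

lemma
  shows mul_add_left: "(x + y) \<cdot> z = x \<cdot> z + y \<cdot> z"
    and mul_scale_left: "(r *s x) \<cdot> z = r *s (x \<cdot> z)"
    and mul_zero_left: "0 \<cdot> z = 0"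
proof -
  interpret L: Vector_Spaces.linear scale scale "\<lambda>x. x \<cdot> z"
    by (rule linear_mul_left)
  show "(x + y) \<cdot> z = x \<cdot> z + y \<cdot> z" "(r *s x) \<cdot> z = r *s (x \<cdot> z)" "0 \<cdot> z = 0"
    by (rule L.add L.scale L.zero)+
qed

lemma
  shows mul_add_right: "z \<cdot> (x + y) = z \<cdot> x + z \<cdot> y"
    and mul_diff_right: "z \<cdot> (x - y) = z \<cdot> x - z \<cdot> y"
    and mul_scale_right: "z \<cdot> (r *s x) = r *s (z \<cdot> x)"
    and mul_zero_right: "z \<cdot> 0 = 0"
proof -
  interpret R: Vector_Spaces.linear scale scale "\<lambda>x. z \<cdot> x"
    by (rule linear_mul_right)
  show "z \<cdot> (x + y) = z \<cdot> x + z \<cdot> y" "z \<cdot> (x - y) = z \<cdot> x - z \<cdot> y"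
    "z \<cdot> (r *s x) = r *s (z \<cdot> x)" "z \<cdot> 0 = 0"
    by (rule R.add R.diff R.scale R.zero)+
qed

lemma subspace_AC_l: "subspace (AC_l mul)"
  unfolding subspace_def AC_l_def
  by (simp add: mul_add_left mul_add_right mul_scale_left mul_scale_right
      mul_zero_left mul_zero_right)

lemma subspace_AC_l_one: "subspace (AC_l_one mul one_l)"
  using subspace_AC_l unfolding subspace_def Ball_def AC_l_one_iff
  by (simp add: mul_add_left mul_scale_left mul_zero_left)

lemma subalgebra_AC_l_one: "subalgebra scale mul (AC_l_one mul one_l)"
  unfolding subalgebra_def using subspace_AC_l_one AC_l_one_mul_closed by blast

lemma commutative_on_AC_l_one: "commutative_on mul (AC_l_one mul one_l)"
  unfolding commutative_on_def using AC_l_one_commute by blast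

lemma associative_on_AC_l_one: "associative_on mul (AC_l_one mul one_l)"
  unfolding associative_on_def using mul_AC_l_one_left AC_l_one_iff by blast

lemma square_AC_l_one_annihilates_associators:
  "set_square mul (AC_l_one mul one_l) \<subseteq> left_annihilator mul (associators mul)"
  by (auto simp: set_square_def left_annihilator_def associators_def associator_def
      AC_l_one_iff mul_diff_right product_rebracket)

end

theorem theorem42:
  fixes scale :: "'f::field \<Rightarrow> 'a::ab_group_add \<Rightarrow> 'a"
    and mul :: "'a \<Rightarrow> 'a \<Rightarrow> 'a"
    and one_l :: 'a
  assumes "left_unital_algebra scale mul one_l"
  shows "subalgebra scale mul (AC_l_one mul one_l) \<and>
         commutative_on mul (AC_l_one mul one_l) \<and>
         associative_on mul (AC_l_one mul one_l) \<and>
         set_square mul (AC_l_one mul one_l) \<subseteq> left_annihilator mul (associators mul)"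
proof -
  interpret left_unital_algebra scale mul one_l
    by (rule assms)
  show ?thesis
    using subalgebra_AC_l_one commutative_on_AC_l_one associative_on_AC_l_one
      square_AC_l_one_annihilates_associators by blast
qed

end
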